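(* The $\ell^2$-norm of the (infinite-time-domain) two-level MGRIT error propagator $\mathcal E_i$ is $$\|\mathcal E_i\|_2=\sup_{\theta\in\Theta^{\rm low}}\big\|\widehat{\mathcal E}_i(\theta)\big\|_2=|\lambda_i|^{m\nu}\,\frac{|\lambda_i^m-\mu_i|}{1-|\mu_i|}\,\sqrt{\frac{1-|\lambda_i|^{2m}}{1-|\lambda_i|^2}}.$$ Furthermore, of all the harmonic spaces $\mathcal H^\theta_{\delta t}$ with $\theta\in\Theta^{\rm low}$, the one with the least error reduction is that associated with the frequency $\theta=\theta_i^\dagger$, where $$\theta_i^\dagger:=\operatorname*{arg\,max}_{\theta\in\Theta^{\rm low}}\big\|\widehat{\mathcal E}_i(\theta)\big\|_2=\frac1m\arg\mu_i ,$$ in which $\arg\mu_i$ denotes the argument (in $[-\pi,\pi)$) of the complex number $\mu_i$.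
   Context: Let $m\in\mathbb{N}$ be the coarsening factor, $\Theta^{\rm low}=[-\pi/m,\pi/m)$, and let $\lambda_i,\mu_i\in\mathbb{C}$ with $|\lambda_i|<1$, $|\mu_i|<1$ be the $i$th eigenvalues of the fine- and coarse-grid MGRIT time-stepping operators, respectively, which are assumed to be simultaneously diagonalizable by a unitary matrix. Let $\nu\in\mathbb{N}_0$ be the number of CF-relaxation sweeps in the pre-relaxation (with $0^0=1$). Let $\mathbf 1\in\mathbb{R}^m$ be the column vector of ones, and let $\delta t$ be the fine-grid time step. Error propagator. For $n_t$ time points ($m\mid n_t$), $$\mathcal E_i=S^{\rm F}_i\big(I_{n_t}-P_iA_{1,i}^{-1}P_i^\top A_{0,i}\big)(S^{\rm CF}_i)^\nu S^{\rm F}_i,$$ with $A_{0,i}=I_{n_t}-\lambda_iL_{n_t}$, $A_{1,i}=I_{n_t/m}-\mu_iL_{n_t/m}$, $P_i=I_{n_t/m}\otimes\mathbf e_1$, $S^{\rm F}_i=I_{n_t/m}\otimes[v(\lambda_i)\mathbf e_1^\top]$, $S^{\rm CF}_i=L_{n_t/m}\otimes[\lambda_iv(\lambda_i)\mathbf e_m^\top]$, where $L_n$ is the $n\times n$ lower shift matrix (ones on the first subdiagonal, zeros elsewhere), $v(\lambda)=(1,\lambda,\dots,\lambda^{m-1})^\top$, and $\mathbf e_1,\mathbf e_m\in\mathbb{R}^m$ are the first and $m$th canonical basis vectors. In the local Fourier analysis (LFA) setting of the statement, $\mathcal E_i$ denotes the infinite-dimensional extension of this operator to semi-infinite temporal grids,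 with the effects of boundary conditions ignored (the initial condition and the outflow condition at the final time are replaced by a periodic boundary condition). Harmonic spaces and symbols. With $\boldsymbol\varphi_0(\theta)$ the fine-grid Fourier mode with entries $e^{\mathrm i\theta k}$ at time points $t_k=k\,\delta t$, define $\mathcal H^\theta_{\delta t}=\operatorname{span}_{0\le\alpha<m}\{\boldsymbol\varphi_0(\theta+2\pi\alpha/m)\}$ for $\theta\in\Theta^{\rm low}$. Each $\mathcal H^\theta_{\delta t}$ is invariant under $\mathcal E_i$, and $\mathcal E_i$ is represented there by its Fourier symbol $$\widehat{\mathcal E}_i(\theta)=\widehat S^{\rm F}_i(\theta)\Big(I_m-\widehat P_i(\theta)\big[\widehat A_{1,i}(m\theta)\big]^{-1}\widehat P_i^\top(\theta)\,\widehat A_{0,i}(\theta)\Big)\big(\widehat S^{\rm CF}_i(\theta)\big)^\nu\,\widehat S^{\rm F}_i(\theta)\in\mathbb{C}^{m\times m},$$ where $\widehat A_{0,i}(\theta)=\operatorname{diag}_{0\le\alpha<m}(1-\lambda_i e^{-\mathrm i(\theta+2\pi\alpha/m)})$, $\widehat A_{1,i}(m\theta)=1-\mu_i e^{-\mathrm i m\theta}$, $\widehat P_i(\theta)=\frac1{\sqrt m}\mathbf 1$, $\widehat S^{\rm F}_i(\theta)=c(\theta)[\widehat A_{0,i}(\theta)]^{-1}\mathbf 1\mathbf 1^\top$ with $c(\theta)=\frac1m[1-(\lambda_ie^{-\mathrm i\theta})^m]$, and $\widehat S^{\rm CF}_i(\theta)=\widehat S^{\rm F}_i(\theta)[I_m-\widehat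 A_{0,i}(\theta)]$. The operator $\mathcal E_i$ is block diagonalized by a unitary similarity transform as $\operatorname{diag}_{\theta\in\Theta^{\rm low}}(\widehat{\mathcal E}_i(\theta))$, and its $\ell^2$-norm in LFA is, accordingly, $\|\mathcal E_i\|_2=\sup_{\theta\in\Theta^{\rm low}}\|\widehat{\mathcal E}_i(\theta)\|_2$. *)

theory Defs
  imports
    "HOL-Analysis.Infinite_Sum"
    "HOL-Analysis.L2_Norm"
    "Jordan_Normal_Form.Gauss_Jordan_Elimination"
begin

section \<open>The error propagator on an infinite temporal grid\<close>

text \<open>
  A grid function is a sequence indexed by the integers that vanishes off the grid. The
  bi-infinite grid is \<open>UNIV\<close>, the semi-infinite one is \<open>{0..}\<close>. The lower shift matrix becomes
  the shift \<open>u \<mapsto> (\<lambda>k. u (k - 1))\<close>: on \<open>{0..}\<close> its first entry is \<open>0\<close>, as for the finite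
  matrix, while on \<open>UNIV\<close> there is no boundary at all. Coarsening by any factor maps either
  grid to itself, so fine and coarse grid functions live in the same space.
\<close>

definition l2_seq :: "int set \<Rightarrow> (int \<Rightarrow> complex) set" where
  "l2_seq grid = {u. (\<forall>k. k \<notin> grid \<longrightarrow> u k = 0) \<and> (\<lambda>k. (cmod (u k))\<^sup>2) summable_on UNIV}"

definition l2_norm :: "(int \<Rightarrow> complex) \<Rightarrow> real" where
  "l2_norm u = sqrt (\<Sum>\<^sub>\<infinity>k. (cmod (u k))\<^sup>2)"

definition l2_opnorm :: "int set \<Rightarrow> ((int \<Rightarrow> complex) \<Rightarrow> (int \<Rightarrow> complex)) \<Rightarrow> real" where
  "l2_opnorm grid T =
     Inf {C. C \<ge> 0 \<and> (\<forall>u\<in>l2_seq grid. T u \<in> l2_seq grid \<and> l2_norm (T u) \<le> C * l2_norm u)}"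

text \<open>\<open>I - a L\<close>; with \<open>a = \<lambda>\<close> on the fine grid and \<open>a = \<mu>\<close> on the coarse grid.\<close>

definition time_step_op :: "complex \<Rightarrow> (int \<Rightarrow> complex) \<Rightarrow> (int \<Rightarrow> complex)" where
  "time_step_op a u = (\<lambda>k. u k - a * u (k - 1))"

text \<open>
  The fine index \<open>k = m j + r\<close> with \<open>0 \<le> r < m\<close> is the \<open>r\<close>-th entry of the \<open>j\<close>-th block in the
  Kronecker products: \<open>I \<otimes> e\<^sub>1\<close> and its transpose, \<open>I \<otimes> v(\<lambda>) e\<^sub>1\<^sup>T\<close>, and
  \<open>L \<otimes> \<lambda> v(\<lambda>) e\<^sub>m\<^sup>T\<close>. The last one reads the last entry of the preceding block,
  which has index \<open>m j - 1\<close>.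
\<close>

definition interp_op :: "nat \<Rightarrow> (int \<Rightarrow> complex) \<Rightarrow> (int \<Rightarrow> complex)" where
  "interp_op m w = (\<lambda>k. if k mod int m = 0 then w (k div int m) else 0)"

definition restrict_op :: "nat \<Rightarrow> (int \<Rightarrow> complex) \<Rightarrow> (int \<Rightarrow> complex)" where
  "restrict_op m u = (\<lambda>j. u (int m * j))"

definition F_relax_op :: "nat \<Rightarrow> complex \<Rightarrow> (int \<Rightarrow> complex) \<Rightarrow> (int \<Rightarrow> complex)" where
  "F_relax_op m lam u = (\<lambda>k. lam ^ nat (k mod int m) * u (int m * (k div int m)))"

definition CF_relax_op :: "nat \<Rightarrow> complex \<Rightarrow> (int \<Rightarrow> complex) \<Rightarrow> (int \<Rightarrow> complex)" where
  "CF_relax_op m lam u =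
     (\<lambda>k. lam * lam ^ nat (k mod int m) * u (int m * (k div int m) - 1))"

text \<open>\<open>I - P A\<^sub>1\<^sup>-\<^sup>1 P\<^sup>T A\<^sub>0\<close>; for \<open>|\<mu>| < 1\<close> the operator \<open>A\<^sub>1\<close> is a bijection of \<open>\<ell>\<^sup>2\<close>.\<close>

definition coarse_correction_op ::
    "int set \<Rightarrow> nat \<Rightarrow> complex \<Rightarrow> complex \<Rightarrow> (int \<Rightarrow> complex) \<Rightarrow> (int \<Rightarrow> complex)" where
  "coarse_correction_op grid m lam mu u =
     (\<lambda>k. u k - interp_op m
        (inv_into (l2_seq grid) (time_step_op mu) (restrict_op m (time_step_op lam u))) k)"

definition error_propagator ::
    "int set \<Rightarrow> nat \<Rightarrow> complex \<Rightarrow> complex \<Rightarrow> nat \<Rightarrow> (int \<Rightarrow> complex) \<Rightarrow> (int \<Rightarrow> complex)" where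
  "error_propagator grid m lam mu nu =
     F_relax_op m lam \<circ> coarse_correction_op grid m lam mu \<circ>
     (CF_relax_op m lam ^^ nu) \<circ> F_relax_op m lam"


section \<open>Fourier symbols\<close>

definition low_freqs :: "nat \<Rightarrow> real set" where
  "low_freqs m = {- pi / real m ..< pi / real m}"

definition A0_symbol :: "nat \<Rightarrow> complex \<Rightarrow> real \<Rightarrow> complex mat" where
  "A0_symbol m lam \<theta> =
     mat_diag m (\<lambda>\<alpha>. 1 - lam * exp (- \<i> * of_real (\<theta> + 2 * pi * real \<alpha> / real m)))"

text \<open>The argument is the coarse frequency, that is, \<open>m\<close> times the fine frequency.\<close>

definition A1_symbol :: "complex \<Rightarrow> real \<Rightarrow> complex" where
  "A1_symbol mu \<omega> = 1 - mu * exp (- \<i> * of_real \<omega>)"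

definition ones_mat :: "nat \<Rightarrow> complex mat" where
  "ones_mat m = mat m 1 (\<lambda>_. 1)"

definition P_symbol :: "nat \<Rightarrow> complex mat" where
  "P_symbol m = of_real (1 / sqrt (real m)) \<cdot>\<^sub>m ones_mat m"

text \<open>\<open>mat_inverse\<close> returns \<open>None\<close> only for singular matrices; \<open>A0_symbol\<close> is invertible if
  \<open>|\<lambda>| < 1\<close>.\<close>

definition F_symbol :: "nat \<Rightarrow> complex \<Rightarrow> real \<Rightarrow> complex mat" where
  "F_symbol m lam \<theta> =
     (1 / of_nat m * (1 - (lam * exp (- \<i> * of_real \<theta>)) ^ m)) \<cdot>\<^sub>m
     (the (mat_inverse (A0_symbol m lam \<theta>)) * (ones_mat m * transpose_mat (ones_mat m)))"

definition CF_symbol :: "nat \<Rightarrow> complex \<Rightarrow> real \<Rightarrow> complex mat" where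
  "CF_symbol m lam \<theta> = F_symbol m lam \<theta> * (1\<^sub>m m - A0_symbol m lam \<theta>)"

definition error_symbol :: "nat \<Rightarrow> complex \<Rightarrow> complex \<Rightarrow> nat \<Rightarrow> real \<Rightarrow> complex mat" where
  "error_symbol m lam mu nu \<theta> =
     F_symbol m lam \<theta> *
     (1\<^sub>m m - P_symbol m * (inverse (A1_symbol mu (real m * \<theta>)) \<cdot>\<^sub>m
        (transpose_mat (P_symbol m) * A0_symbol m lam \<theta>))) *
     (CF_symbol m lam \<theta> ^\<^sub>m nu) * F_symbol m lam \<theta>"

definition vec_norm2 :: "complex vec \<Rightarrow> real" where
  "vec_norm2 v = L2_set (\<lambda>i. cmod (v $ i)) {..<dim_vec v}"

definition mat_norm2 :: "complex mat \<Rightarrow> real" where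
  "mat_norm2 A = (SUP v\<in>{v \<in> carrier_vec (dim_col A). vec_norm2 v \<le> 1}. vec_norm2 (A *\<^sub>v v))"

text \<open>The argument in \<open>[-\<pi>, \<pi>)\<close>; the library's \<^const>\<open>Arg\<close> takes values in \<open>(-\<pi>, \<pi>]\<close>. As for
  \<^const>\<open>Arg\<close>, the argument of \<open>0\<close> is \<open>0\<close>.\<close>

definition arg_left :: "complex \<Rightarrow> real" where
  "arg_left z = (if Arg z = pi then - pi else Arg z)"

end

theory Submission
  imports Defs
begin

text \<open>
  F-relaxation at both ends reduces the error propagator to a scalar on each harmonic space. At
  frequency \<open>\<theta>\<close> the F-relaxation symbol is \<open>f 1\<^sup>T\<close> with \<open>f = c A\<^sub>0\<^sup>-\<^sup>1 1\<close> and \<open>1\<^sup>T f = 1\<close>: a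
  projection of rank one. CF-relaxation maps \<open>f\<close> to \<open>q f\<close> with \<open>q = \<lambda>\<^sup>m e\<^bsup>-im\<theta>\<^esup>\<close>, and
  F-relaxation after the coarse-grid correction maps \<open>f\<close> to
  \<open>(1 - (1 - q) / (1 - \<mu> e\<^bsup>-im\<theta>\<^esup>)) f\<close>. So the symbol is a scalar multiple of \<open>f 1\<^sup>T\<close>.
  The entries of \<open>f\<close> are the discrete Fourier transform of \<open>\<lambda>\<^sup>r e\<^bsup>-ir\<theta>\<^esup> / m\<close>, \<open>0 \<le> r < m\<close>, so
  by Parseval the norm of \<open>f 1\<^sup>T\<close> is \<open>(\<Sum>r<m. |\<lambda>|\<^bsup>2r\<^esup>)\<^bsup>1/2\<^esup>\<close> at every frequency
  (lemma \<open>mat_norm2_error_symbol\<close>). The frequency enters the norm only through the denominator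
  \<open>|1 - \<mu> e\<^bsup>-im\<theta>\<^esup>|\<close>, whose minimum \<open>1 - |\<mu>|\<close> is attained where \<open>m\<theta>\<close> is the argument of \<open>\<mu>\<close>.

  The operator norm is computed in the time domain, by an argument that covers the bi-infinite
  and the semi-infinite grid alike. With \<open>S\<close> the shift on the coarse grid and \<open>w\<close> the values of
  \<open>u\<close> at the coarse points, the error propagator maps \<open>u\<close> to the block-wise extension
  (\<open>d\<^sub>j, \<lambda> d\<^sub>j, \<dots>, \<lambda>\<^bsup>m-1\<^esup> d\<^sub>j\<close>) of the solution \<open>d\<close> of
  \<open>(I - \<mu> S) d = \<lambda>\<^bsup>m\<nu>\<^esup> (\<lambda>\<^sup>m - \<mu>) S\<^bsup>\<nu>+1\<^esup> w\<close> (lemma \<open>error_propagator_coarse_form\<close>). The extension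
  multiplies norms by \<open>(\<Sum>r<m. |\<lambda>|\<^bsup>2r\<^esup>)\<^bsup>1/2\<^esup>\<close>, and \<open>(I - \<mu> S)\<^sup>-\<^sup>1\<close> has norm \<open>1 / (1 - |\<mu>|)\<close>: the
  upper bound is the triangle inequality, and the lower bound comes from Fourier modes at the
  frequency \<open>arg \<mu>\<close>, truncated to long finite intervals (lemma \<open>truncated_mode\<close>). Truncated modes
  can be placed on the half-line, which is why the semi-infinite grid gives the same norm.
\<close>

section \<open>Matrices with constant rows\<close>

text \<open>
  The matrix \<open>a 1\<^sup>T\<close>. Such matrices form a left ideal, to which the F-relaxation symbol, and with
  it every product ending in that symbol, belongs.
\<close>

definition row_constant_mat :: "nat \<Rightarrow> (nat \<Rightarrow> complex) \<Rightarrow> complex mat" where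
  "row_constant_mat m a = mat m m (\<lambda>(i, j). a i)"

lemma row_constant_mat_carrier [simp]: "row_constant_mat m a \<in> carrier_mat m m"
  by (simp add: row_constant_mat_def)

lemma row_constant_mat_dim [simp]:
  "dim_row (row_constant_mat m a) = m" "dim_col (row_constant_mat m a) = m"
  by (simp_all add: row_constant_mat_def)

lemma mat_mult_row_constant_mat:
  assumes "M \<in> carrier_mat m m"
  shows "M * row_constant_mat m a = row_constant_mat m (\<lambda>i. \<Sum>j<m. M $$ (i, j) * a j)"
  using assms
  by (intro eq_matI) (auto simp: row_constant_mat_def scalar_prod_def atLeast0LessThan)

lemma mat_mult_row_constant_mat_eq:
  assumes "M \<in> carrier_mat m m"
    and "\<And>i. i < m \<Longrightarrow> (\<Sum>j<m. M $$ (i, j) * a j) = b i"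
  shows "M * row_constant_mat m a = row_constant_mat m b"
  unfolding mat_mult_row_constant_mat[OF assms(1)]
  by (rule eq_matI) (auto simp: row_constant_mat_def assms(2))

lemma vec_norm2_row_constant_mat_mult:
  assumes "v \<in> carrier_vec m"
  shows "vec_norm2 (row_constant_mat m a *\<^sub>v v)
    = cmod (\<Sum>j<m. v $ j) * L2_set (\<lambda>i. cmod (a i)) {..<m}"
proof -
  have "vec_norm2 (row_constant_mat m a *\<^sub>v v)
      = L2_set (\<lambda>i. cmod (\<Sum>j<m. v $ j) * cmod (a i)) {..<m}"
    unfolding vec_norm2_def using assms
    by (intro L2_set_cong)
       (auto simp: row_constant_mat_def scalar_prod_def atLeast0LessThan
          norm_mult[symmetric] sum_distrib_left[symmetric] mult.commute)
  then show ?thesis by (simp add: L2_set_right_distrib)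
qed

text \<open>
  Since \<open>a 1\<^sup>T v = (1\<^sup>T v) a\<close>, the bound is the Cauchy-Schwarz inequality for \<open>1\<^sup>T v\<close>, with
  equality for constant \<open>v\<close>.
\<close>

lemma mat_norm2_row_constant_mat:
  assumes "m \<ge> 1"
  shows "mat_norm2 (row_constant_mat m a) = sqrt (real m) * L2_set (\<lambda>i. cmod (a i)) {..<m}"
  unfolding mat_norm2_def
proof (rule cSup_eq_maximum)
  define v :: "complex vec" where "v = vec m (\<lambda>_. of_real (1 / sqrt (real m)))"
  have v: "v \<in> carrier_vec m" by (simp add: v_def)
  have "vec_norm2 v = L2_set (\<lambda>i. 1 / sqrt (real m)) {..<m}"
    unfolding vec_norm2_def v_def by (intro L2_set_cong) (auto simp: norm_divide)
  also have "\<dots> = 1"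
    using assms by (simp add: L2_set_constant)
  finally have norm_v: "vec_norm2 v \<le> 1" by simp
  have "(\<Sum>j<m. v $ j) = of_real (real m / sqrt (real m))"
    by (simp add: v_def)
  then have "cmod (\<Sum>j<m. v $ j) = sqrt (real m)"
    by (simp only: norm_of_real) (simp add: real_div_sqrt)
  then have "vec_norm2 (row_constant_mat m a *\<^sub>v v)
      = sqrt (real m) * L2_set (\<lambda>i. cmod (a i)) {..<m}"
    by (simp add: vec_norm2_row_constant_mat_mult[OF v])
  then show "sqrt (real m) * L2_set (\<lambda>i. cmod (a i)) {..<m}
      \<in> (\<lambda>v. vec_norm2 (row_constant_mat m a *\<^sub>v v)) `
        {v \<in> carrier_vec (dim_col (row_constant_mat m a)). vec_norm2 v \<le> 1}"
    using v norm_v by (intro image_eqI[of _ _ v]) auto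
next
  fix y
  assume "y \<in> (\<lambda>v. vec_norm2 (row_constant_mat m a *\<^sub>v v)) `
        {v \<in> carrier_vec (dim_col (row_constant_mat m a)). vec_norm2 v \<le> 1}"
  then obtain v where v: "v \<in> carrier_vec m" "vec_norm2 v \<le> 1"
    and y: "y = cmod (\<Sum>j<m. v $ j) * L2_set (\<lambda>i. cmod (a i)) {..<m}"
    by (auto simp: vec_norm2_row_constant_mat_mult)
  have "cmod (\<Sum>j<m. v $ j) \<le> (\<Sum>j<m. \<bar>1\<bar> * \<bar>cmod (v $ j)\<bar>)"
    by (simp add: norm_sum)
  also have "\<dots> \<le> L2_set (\<lambda>_. 1) {..<m} * L2_set (\<lambda>j. cmod (v $ j)) {..<m}"
    by (rule L2_set_mult_ineq)
  also have "\<dots> \<le> sqrt (real m) * 1"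
    using v by (intro mult_mono) (auto simp: L2_set_constant vec_norm2_def)
  finally show "y \<le> sqrt (real m) * L2_set (\<lambda>i. cmod (a i)) {..<m}"
    unfolding y by (intro mult_right_mono) auto
qed

lemma mat_inverse_mat_diag:
  fixes d :: "nat \<Rightarrow> complex"
  assumes "\<And>i. i < n \<Longrightarrow> d i \<noteq> 0"
  shows "the (mat_inverse (mat_diag n d)) = mat_diag n (\<lambda>i. inverse (d i))"
proof -
  let ?D = "mat_diag n d" and ?I = "mat_diag n (\<lambda>i. inverse (d i))"
  have inv: "?D * ?I = 1\<^sub>m n" "?I * ?D = 1\<^sub>m n"
    using assms by (auto intro!: eq_matI simp: mat_diag_def scalar_prod_def if_distrib[where f="\<lambda>x. x * _"] cong: if_cong)
  have "?D \<in> Units (ring_mat TYPE(complex) n ())"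
    unfolding Units_def ring_mat_def using inv by (auto intro!: bexI[of _ ?I])
  then obtain B where B: "mat_inverse ?D = Some B"
    using mat_inverse(1)[where b = "()", OF mat_diag_dim, of n d] by (cases "mat_inverse ?D") auto
  from mat_inverse(2)[OF mat_diag_dim B]
  have "?D * B = 1\<^sub>m n" "B \<in> carrier_mat n n" by auto
  have "B = (?I * ?D) * B"
    using \<open>B \<in> carrier_mat n n\<close> by (simp only: inv left_mult_one_mat)
  also have "\<dots> = ?I * (?D * B)"
    using \<open>B \<in> carrier_mat n n\<close> by (rule assoc_mult_mat[OF mat_diag_dim mat_diag_dim])
  also have "\<dots> = ?I" using \<open>?D * B = 1\<^sub>m n\<close> right_mult_one_mat[OF mat_diag_dim] by metis
  finally show ?thesis using B by simp
qed

section \<open>The discrete Fourier transform on the harmonics\<close>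

lemma cis_eq_1_iff: "cis x = 1 \<longleftrightarrow> (\<exists>n::int. x = of_int n * 2 * pi)"
proof -
  have "cis x = 1 \<longleftrightarrow> cos x = 1 \<and> sin x = 0"
    by (simp add: complex_eq_iff)
  also have "\<dots> \<longleftrightarrow> cos x = 1"
    using sin_cos_squared_add[of x] by (auto simp: power2_eq_square)
  finally show ?thesis
    by (simp add: cos_one_2pi_int)
qed

lemma sum_roots_of_unity_orthogonal:
  assumes "r < m" and "s < m"
  shows "(\<Sum>i<m. cis (- (2 * pi * real i / real m)) ^ r
          * cnj (cis (- (2 * pi * real i / real m)) ^ s))
        = (if r = s then of_nat m else 0)"
proof -
  define x where "x = cis (2 * pi * (real s - real r) / real m)"
  have summand: "cis (- (2 * pi * real i / real m)) ^ r
      * cnj (cis (- (2 * pi * real i / real m)) ^ s) = x ^ i" for i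
    unfolding x_def complex_cnj_power cis_cnj DeMoivre cis_mult
    by (rule arg_cong[where f = cis]) (use assms in \<open>simp add: field_simps\<close>)
  have "x ^ m = cis (2 * pi * (real s - real r))"
    unfolding x_def DeMoivre
    by (rule arg_cong[where f = cis]) (use assms in \<open>simp add: field_simps\<close>)
  also have "\<dots> = 1"
    unfolding cis_eq_1_iff by (auto intro!: exI[of _ "int s - int r"])
  finally have xm: "x ^ m = 1" .
  show ?thesis
  proof (cases "r = s")
    case True
    then show ?thesis unfolding summand by (simp add: x_def)
  next
    case False
    have "x \<noteq> 1"
    proof
      assume "x = 1"
      then obtain n :: int where n: "2 * pi * (real s - real r) / real m = of_int n * 2 * pi"
        unfolding x_def cis_eq_1_iff by auto
      then have "2 * pi * (real s - real r) = 2 * pi * (of_int n * real m)"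
        using assms by (simp add: field_simps)
      then have "real s - real r = of_int n * real m"
        by simp
      then have "int s - int r = n * int m"
        by (metis of_int_diff of_int_eq_iff of_int_mult of_int_of_nat_eq)
      then have "int m dvd int s - int r" by simp
      then have "int s - int r = 0"
        using assms dvd_imp_le_int[of "int s - int r" "int m"] by linarith
      with False show False by simp
    qed
    then show ?thesis
      unfolding summand using False geometric_sum[of x m] xm by simp
  qed
qed

lemma parseval_DFT:
  fixes b :: "nat \<Rightarrow> complex"
  shows "(\<Sum>i<m. (cmod (\<Sum>r<m. b r * cis (- (2 * pi * real i / real m)) ^ r))\<^sup>2)
      = real m * (\<Sum>r<m. (cmod (b r))\<^sup>2)"
proof -
  define e where "e = (\<lambda>i. cis (- (2 * pi * real i / real m)))"
  have "complex_of_real (\<Sum>i<m. (cmod (\<Sum>r<m. b r * e i ^ r))\<^sup>2)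
      = (\<Sum>i<m. \<Sum>r<m. \<Sum>s<m. (b r * cnj (b s)) * (e i ^ r * cnj (e i ^ s)))"
    unfolding of_real_sum complex_norm_square cnj_sum sum_product
    by (intro sum.cong refl) (simp add: mult_ac)
  also have "\<dots> = (\<Sum>r<m. \<Sum>s<m. (b r * cnj (b s)) * (\<Sum>i<m. e i ^ r * cnj (e i ^ s)))"
    unfolding sum_distrib_left
    by (subst sum.swap, rule sum.cong[OF refl], subst sum.swap) (rule refl)
  also have "\<dots> = (\<Sum>r<m. \<Sum>s<m. (b r * cnj (b s)) * (if r = s then of_nat m else 0))"
    unfolding e_def
    by (intro sum.cong refl arg_cong2[where f = "(*)"] sum_roots_of_unity_orthogonal) auto
  also have "\<dots> = complex_of_real (real m * (\<Sum>r<m. (cmod (b r))\<^sup>2))"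
    by (simp add: complex_norm_square sum_distrib_left mult_ac if_distrib[where f = "\<lambda>x. _ * x"]
        del: of_real_power cong: if_cong)
  finally show ?thesis unfolding e_def of_real_eq_iff .
qed

lemma sum_DFT:
  fixes b :: "nat \<Rightarrow> complex"
  assumes "m \<ge> 1"
  shows "(\<Sum>i<m. \<Sum>r<m. b r * cis (- (2 * pi * real i / real m)) ^ r) = of_nat m * b 0"
proof -
  have "(\<Sum>i<m. \<Sum>r<m. b r * cis (- (2 * pi * real i / real m)) ^ r)
      = (\<Sum>r<m. b r * (\<Sum>i<m. cis (- (2 * pi * real i / real m)) ^ r))"
    unfolding sum_distrib_left by (rule sum.swap)
  also have "\<dots> = (\<Sum>r<m. if r = 0 then of_nat m * b r else 0)"
    using assms sum_roots_of_unity_orthogonal[of _ m 0]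
    by (intro sum.cong refl) auto
  finally show ?thesis using assms by simp
qed

section \<open>The norm of the Fourier symbol\<close>

text \<open>
  One harmonic space. There the fine time step acts on the harmonic with index \<open>\<alpha>\<close> as
  multiplication by \<open>step_symbol \<alpha>\<close>. All harmonics alias to one coarse Fourier mode, on which
  \<open>m\<close> fine steps act as multiplication by \<open>q\<close>. The vector \<open>F_profile\<close>, the \<open>f\<close> of the
  introduction, spans the range of F-relaxation.
\<close>

locale two_level_symbol =
  fixes m :: nat and lam :: complex and \<theta> :: real
  assumes m_pos: "m \<ge> 1" and lam: "cmod lam < 1"
begin

definition step_symbol :: "nat \<Rightarrow> complex" where
  "step_symbol \<alpha> = lam * cis (- \<theta>) * cis (- (2 * pi * real \<alpha> / real m))"

definition q :: complex where
  "q = (lam * cis (- \<theta>)) ^ m"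

definition F_profile :: "nat \<Rightarrow> complex" where
  "F_profile \<alpha> = 1 / of_nat m * (1 - q) * inverse (1 - step_symbol \<alpha>)"

lemma step_symbol_neq_1: "1 - step_symbol \<alpha> \<noteq> 0"
proof -
  have "cmod (step_symbol \<alpha>) < 1" using lam by (simp add: step_symbol_def norm_mult)
  then show ?thesis by auto
qed

lemma step_symbol_power: "step_symbol \<alpha> ^ m = q"
proof -
  have "cis (- (2 * pi * real \<alpha> / real m)) ^ m = cis (- (2 * pi * real \<alpha>))"
    unfolding DeMoivre using m_pos by (intro arg_cong[where f = cis]) simp
  also have "\<dots> = 1"
    unfolding cis_eq_1_iff by (intro exI[of _ "- int \<alpha>"]) simp
  finally show ?thesis by (simp add: step_symbol_def q_def power_mult_distrib)
qed

text \<open>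
  The quotient \<open>(1 - z\<^sup>m) / (1 - z)\<close> is a finite geometric series. Its \<open>r\<close>-th term comes from
  the \<open>r\<close>-th point of a block, to which F-relaxation carries the coarse value, multiplied by \<open>\<lambda>\<^sup>r\<close>.
\<close>

lemma F_profile_eq_DFT:
  "F_profile \<alpha>
    = (\<Sum>r<m. (1 / of_nat m * (lam * cis (- \<theta>)) ^ r) * cis (- (2 * pi * real \<alpha> / real m)) ^ r)"
proof -
  have "(\<Sum>r<m. step_symbol \<alpha> ^ r) = (1 - q) * inverse (1 - step_symbol \<alpha>)"
    using step_symbol_neq_1[of \<alpha>] by (subst geometric_sum) (auto simp: step_symbol_power field_simps)
  then have "F_profile \<alpha> = 1 / of_nat m * (\<Sum>r<m. step_symbol \<alpha> ^ r)"
    by (simp add: F_profile_def mult.assoc)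
  then show ?thesis
    unfolding sum_distrib_left by (simp add: step_symbol_def power_mult_distrib)
qed

lemma sum_F_profile: "(\<Sum>\<alpha><m. F_profile \<alpha>) = 1"
  unfolding F_profile_eq_DFT sum_DFT[OF m_pos] using m_pos by simp

lemma sum_norm_F_profile: "(\<Sum>\<alpha><m. (cmod (F_profile \<alpha>))\<^sup>2) = (\<Sum>r<m. cmod lam ^ (2 * r)) / real m"
proof -
  have "(cmod (1 / of_nat m * (lam * cis (- \<theta>)) ^ r))\<^sup>2 = cmod lam ^ (2 * r) / (real m)\<^sup>2" for r
    by (simp add: norm_mult norm_divide norm_power power_divide power_mult[symmetric] mult.commute)
  then have "(\<Sum>\<alpha><m. (cmod (F_profile \<alpha>))\<^sup>2) = real m * (\<Sum>r<m. cmod lam ^ (2 * r) / (real m)\<^sup>2)"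
    unfolding F_profile_eq_DFT parseval_DFT by simp
  then show ?thesis
    by (simp add: sum_divide_distrib[symmetric] power2_eq_square)
qed

lemma sum_A0_F_profile: "(\<Sum>\<alpha><m. (1 - step_symbol \<alpha>) * F_profile \<alpha>) = 1 - q"
proof -
  have "(1 - step_symbol \<alpha>) * F_profile \<alpha> = (1 - q) / of_nat m" for \<alpha>
    using step_symbol_neq_1[of \<alpha>] by (simp add: F_profile_def)
  then show ?thesis using m_pos by simp
qed

lemma A0_symbol_eq: "A0_symbol m lam \<theta> = mat_diag m (\<lambda>\<alpha>. 1 - step_symbol \<alpha>)"
proof -
  have "lam * exp (- \<i> * of_real (\<theta> + 2 * pi * real \<alpha> / real m)) = step_symbol \<alpha>" for \<alpha>
  proof -
    have "exp (- \<i> * of_real (\<theta> + 2 * pi * real \<alpha> / real m))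
        = cis (- \<theta> + - (2 * pi * real \<alpha> / real m))"
      unfolding cis_conv_exp by (rule arg_cong[where f = exp]) (simp add: algebra_simps)
    then show ?thesis by (simp add: step_symbol_def cis_mult)
  qed
  then show ?thesis by (simp add: A0_symbol_def)
qed

lemma F_symbol_eq: "F_symbol m lam \<theta> = row_constant_mat m F_profile"
proof -
  have q: "(lam * exp (- \<i> * of_real \<theta>)) ^ m = q"
    by (simp add: q_def cis_conv_exp)
  have ones: "ones_mat m * transpose_mat (ones_mat m) = row_constant_mat m (\<lambda>_. 1)"
    by (rule eq_matI) (auto simp: ones_mat_def row_constant_mat_def scalar_prod_def)
  show ?thesis
    unfolding F_symbol_def A0_symbol_eq mat_inverse_mat_diag[OF step_symbol_neq_1] q ones
      mat_diag_mult_left[OF row_constant_mat_carrier]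
    by (rule eq_matI) (auto simp: row_constant_mat_def F_profile_def)
qed

lemma CF_symbol_carrier: "CF_symbol m lam \<theta> \<in> carrier_mat m m"
  unfolding CF_symbol_def F_symbol_eq A0_symbol_eq
  by (intro mult_carrier_mat[OF row_constant_mat_carrier] minus_carrier_mat) simp

text \<open>
  Each CF-relaxation advances an F-relaxed grid function by one coarse step of the fine
  propagator, so \<open>F_profile\<close> is an eigenvector of its symbol.
\<close>

lemma CF_symbol_mult_profile:
  "CF_symbol m lam \<theta> * row_constant_mat m (\<lambda>\<alpha>. c * F_profile \<alpha>)
    = row_constant_mat m (\<lambda>\<alpha>. q * c * F_profile \<alpha>)"
proof (rule mat_mult_row_constant_mat_eq[OF CF_symbol_carrier])
  have diff: "1\<^sub>m m - A0_symbol m lam \<theta> = mat_diag m step_symbol"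
    by (rule eq_matI) (auto simp: A0_symbol_eq mat_diag_def)
  have CF: "CF_symbol m lam \<theta> = mat m m (\<lambda>(i, j). F_profile i * step_symbol j)"
    unfolding CF_symbol_def diff F_symbol_eq mat_diag_mult_right[OF row_constant_mat_carrier]
    by (rule eq_matI) (auto simp: row_constant_mat_def)
  have sum_step_F_profile: "(\<Sum>j<m. step_symbol j * F_profile j) = q"
    using sum_F_profile sum_A0_F_profile by (simp add: left_diff_distrib sum_subtractf)
  fix i assume "i < m"
  then have "(\<Sum>j<m. CF_symbol m lam \<theta> $$ (i, j) * (c * F_profile j))
      = c * F_profile i * (\<Sum>j<m. step_symbol j * F_profile j)"
    unfolding sum_distrib_left by (intro sum.cong) (auto simp: CF)
  then show "(\<Sum>j<m. CF_symbol m lam \<theta> $$ (i, j) * (c * F_profile j)) = q * c * F_profile i"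
    by (simp add: sum_step_F_profile)
qed

lemma CF_symbol_power_mult_profile:
  "CF_symbol m lam \<theta> ^\<^sub>m nu * row_constant_mat m (\<lambda>\<alpha>. c * F_profile \<alpha>)
    = row_constant_mat m (\<lambda>\<alpha>. q ^ nu * c * F_profile \<alpha>)"
proof (induction nu arbitrary: c)
  case 0
  then show ?case
    using CF_symbol_carrier by (simp add: left_mult_one_mat[OF row_constant_mat_carrier])
next
  case (Suc nu)
  have "CF_symbol m lam \<theta> ^\<^sub>m Suc nu * row_constant_mat m (\<lambda>\<alpha>. c * F_profile \<alpha>)
      = CF_symbol m lam \<theta> ^\<^sub>m nu * (CF_symbol m lam \<theta> * row_constant_mat m (\<lambda>\<alpha>. c * F_profile \<alpha>))"
    unfolding pow_mat.simps
    by (rule assoc_mult_mat[OF pow_carrier_mat CF_symbol_carrier row_constant_mat_carrier])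
      (rule CF_symbol_carrier)
  then show ?case
    unfolding CF_symbol_mult_profile Suc.IH by (simp add: mult_ac)
qed

text \<open>
  Read from right to left, each factor of the symbol maps a matrix \<open>a 1\<^sup>T\<close> to one of the same
  form, and the leftmost F-relaxation turns \<open>g 1\<^sup>T\<close> into a multiple of \<open>F_profile\<close> by the sum of
  the entries of \<open>g\<close>.
\<close>

lemma error_symbol_eq:
  assumes "A1_symbol mu (real m * \<theta>) \<noteq> 0"
  shows "error_symbol m lam mu nu \<theta>
    = row_constant_mat m
        (\<lambda>\<alpha>. q ^ nu * (1 - (1 - q) / A1_symbol mu (real m * \<theta>)) * F_profile \<alpha>)"
proof -
  define a where "a = A1_symbol mu (real m * \<theta>)"
  define M where "M = 1\<^sub>m m
    - P_symbol m * (inverse a \<cdot>\<^sub>m (transpose_mat (P_symbol m) * A0_symbol m lam \<theta>))"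
  have P: "P_symbol m \<in> carrier_mat m 1" by (simp add: P_symbol_def ones_mat_def)
  then have PT: "transpose_mat (P_symbol m) \<in> carrier_mat 1 m" by simp
  have sqrt: "of_real (1 / sqrt (real m)) * of_real (1 / sqrt (real m)) = (1 / of_nat m :: complex)"
    unfolding of_real_mult[symmetric] using m_pos by simp
  have M_eq: "M = mat m m
      (\<lambda>(i, j). (if i = j then 1 else 0) - 1 / of_nat m * inverse a * (1 - step_symbol j))"
    unfolding M_def A0_symbol_eq mat_diag_mult_right[OF PT] sqrt[symmetric]
    by (rule eq_matI) (auto simp: P_symbol_def ones_mat_def scalar_prod_def)
  then have M: "M \<in> carrier_mat m m" by simp
  have F: "F_symbol m lam \<theta> \<in> carrier_mat m m" by (simp add: F_symbol_eq)
  have CF: "CF_symbol m lam \<theta> ^\<^sub>m nu \<in> carrier_mat m m"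
    by (rule pow_carrier_mat[OF CF_symbol_carrier])
  have CF_F: "CF_symbol m lam \<theta> ^\<^sub>m nu * F_symbol m lam \<theta> = row_constant_mat m (\<lambda>\<alpha>. q ^ nu * F_profile \<alpha>)"
    using CF_symbol_power_mult_profile[of nu 1] by (simp add: F_symbol_eq)
  define g where "g = (\<lambda>\<alpha>. q ^ nu * (F_profile \<alpha> - 1 / of_nat m * inverse a * (1 - q)))"
  have M_apply: "M * row_constant_mat m (\<lambda>\<alpha>. q ^ nu * F_profile \<alpha>) = row_constant_mat m g"
  proof (rule mat_mult_row_constant_mat_eq[OF M])
    fix i assume "i < m"
    have "(\<Sum>j<m. M $$ (i, j) * (q ^ nu * F_profile j))
        = (\<Sum>j<m. q ^ nu * ((if i = j then F_profile j else 0)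
            - 1 / of_nat m * inverse a * ((1 - step_symbol j) * F_profile j)))"
      using \<open>i < m\<close> by (intro sum.cong) (auto simp: M_eq algebra_simps)
    also have "\<dots> = g i"
      unfolding g_def sum_distrib_left[symmetric] sum_subtractf sum_A0_F_profile using \<open>i < m\<close> by simp
    finally show "(\<Sum>j<m. M $$ (i, j) * (q ^ nu * F_profile j)) = g i" .
  qed
  have sum_g: "(\<Sum>j<m. g j) = q ^ nu * (1 - (1 - q) / a)"
    using m_pos
    by (simp add: g_def sum_distrib_left[symmetric] sum_subtractf sum_F_profile divide_inverse mult_ac)
  have "error_symbol m lam mu nu \<theta>
      = F_symbol m lam \<theta> * (M * (CF_symbol m lam \<theta> ^\<^sub>m nu * F_symbol m lam \<theta>))"
    unfolding error_symbol_def a_def[symmetric] M_def[symmetric]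
    using F M CF by (simp add: assoc_mult_mat[of _ m m _ m _ m])
  also have "\<dots> = row_constant_mat m F_profile * row_constant_mat m g"
    unfolding CF_F M_apply unfolding F_symbol_eq ..
  also have "\<dots> = row_constant_mat m (\<lambda>\<alpha>. q ^ nu * (1 - (1 - q) / a) * F_profile \<alpha>)"
  proof (rule mat_mult_row_constant_mat_eq[OF row_constant_mat_carrier])
    fix i assume "i < m"
    then have "(\<Sum>j<m. row_constant_mat m F_profile $$ (i, j) * g j) = F_profile i * (\<Sum>j<m. g j)"
      by (simp add: row_constant_mat_def sum_distrib_left)
    then show "(\<Sum>j<m. row_constant_mat m F_profile $$ (i, j) * g j)
        = q ^ nu * (1 - (1 - q) / a) * F_profile i"
      by (simp add: sum_g)
  qed
  finally show ?thesis unfolding a_def .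
qed

text \<open>
  The scalar factor compares \<open>m\<close> fine steps with one coarse step: with \<open>e = e\<^bsup>-im\<theta>\<^esup>\<close> it is
  \<open>q\<^sup>\<nu> (\<lambda>\<^sup>m - \<mu>) e / (1 - \<mu> e)\<close>, and \<open>e\<close> has modulus one.
\<close>

lemma mat_norm2_error_symbol:
  assumes "cmod mu < 1"
  shows "mat_norm2 (error_symbol m lam mu nu \<theta>)
    = cmod lam ^ (m * nu) * cmod (lam ^ m - mu) * sqrt (\<Sum>r<m. cmod lam ^ (2 * r))
      / cmod (1 - mu * cis (- (real m * \<theta>)))"
proof -
  define e where "e = cis (- (real m * \<theta>))"
  have A1: "A1_symbol mu (real m * \<theta>) = 1 - mu * e"
    by (simp add: A1_symbol_def e_def cis_conv_exp)
  have "cmod (mu * e) < 1" using assms by (simp add: e_def norm_mult)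
  then have A1_nz: "1 - mu * e \<noteq> 0" by auto
  have q_e: "q = lam ^ m * e"
    by (simp add: q_def e_def power_mult_distrib DeMoivre)
  define k where "k = q ^ nu * (1 - (1 - q) / (1 - mu * e))"
  have "1 - (1 - q) / (1 - mu * e) = (lam ^ m - mu) * e / (1 - mu * e)"
    using A1_nz by (simp add: q_e field_simps)
  then have norm_k: "cmod k = cmod lam ^ (m * nu) * cmod (lam ^ m - mu) / cmod (1 - mu * e)"
    by (simp add: k_def q_e e_def norm_mult norm_divide norm_power power_mult)
  have "mat_norm2 (error_symbol m lam mu nu \<theta>)
      = sqrt (real m) * L2_set (\<lambda>\<alpha>. cmod k * cmod (F_profile \<alpha>)) {..<m}"
    using A1_nz by (simp add: error_symbol_eq A1 k_def mat_norm2_row_constant_mat[OF m_pos] norm_mult)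
  also have "\<dots> = cmod k * (sqrt (real m) * sqrt ((\<Sum>r<m. cmod lam ^ (2 * r)) / real m))"
    unfolding L2_set_right_distrib[OF norm_ge_zero, symmetric]
    by (simp add: L2_set_def sum_norm_F_profile)
  also have "sqrt (real m) * sqrt ((\<Sum>r<m. cmod lam ^ (2 * r)) / real m) = sqrt (\<Sum>r<m. cmod lam ^ (2 * r))"
    using m_pos by (simp add: real_sqrt_mult[symmetric])
  finally show ?thesis by (simp add: norm_k e_def)
qed

end

section \<open>The frequency of least error reduction\<close>

lemma norm_one_minus_ge:
  fixes w :: complex
  shows "cmod (1 - w) \<ge> 1 - cmod w"
  using norm_triangle_ineq2[of 1 w] by simp

lemma rcis_arg_left: "rcis (cmod w) (arg_left w) = w"
proof -
  have "cis (arg_left w) = cis (Arg w)"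
    by (auto simp: arg_left_def complex_eq_iff)
  then show ?thesis using rcis_cmod_Arg[of w] by (simp add: rcis_def)
qed

lemma arg_left_bounds: "- pi \<le> arg_left w" "arg_left w < pi"
  using Arg_bounded[of w] by (auto simp: arg_left_def)

lemma mult_cis_arg_left: "w * cis (- arg_left w) = of_real (cmod w)"
  by (subst rcis_arg_left[symmetric, of w]) (simp add: rcis_def cis_mult mult.assoc)

text \<open>
  By the cosine rule \<open>|1 - \<rho> e\<^bsup>i\<psi>\<^esup>|\<^sup>2 = (1 - \<rho>)\<^sup>2 + 2\<rho> (1 - cos \<psi>)\<close>, which is minimal only for
  \<open>\<psi>\<close> in \<open>2\<pi>\<int>\<close>; both angles lie in the same half-open period.
\<close>

lemma norm_one_minus_mult_cis_eq_iff:
  assumes "mu \<noteq> 0" "cmod mu < 1" "- pi \<le> \<omega>" "\<omega> < pi"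
  shows "cmod (1 - mu * cis (- \<omega>)) = 1 - cmod mu \<longleftrightarrow> \<omega> = arg_left mu"
proof
  assume "\<omega> = arg_left mu"
  then have "1 - mu * cis (- \<omega>) = of_real (1 - cmod mu)"
    by (simp add: mult_cis_arg_left)
  then show "cmod (1 - mu * cis (- \<omega>)) = 1 - cmod mu"
    using assms(2) by (simp only: norm_of_real)
next
  assume eq: "cmod (1 - mu * cis (- \<omega>)) = 1 - cmod mu"
  define \<psi> where "\<psi> = arg_left mu - \<omega>"
  have "mu * cis (- \<omega>) = of_real (cmod mu) * cis \<psi>"
    by (subst rcis_arg_left[symmetric, of mu]) (simp add: rcis_def cis_mult mult.assoc \<psi>_def)
  then have "(cmod (1 - of_real (cmod mu) * cis \<psi>))\<^sup>2 = (1 - cmod mu)\<^sup>2"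
    using eq by simp
  then have "(1 - cmod mu * cos \<psi>)\<^sup>2 + (cmod mu * sin \<psi>)\<^sup>2 = (1 - cmod mu)\<^sup>2"
    by (simp add: cmod_power2)
  then have "1 - 2 * cmod mu * cos \<psi> + (cmod mu)\<^sup>2 * ((sin \<psi>)\<^sup>2 + (cos \<psi>)\<^sup>2) = (1 - cmod mu)\<^sup>2"
    by (simp add: power2_eq_square algebra_simps del: sin_cos_squared_add sin_cos_squared_add3)
  then have "cmod mu * cos \<psi> = cmod mu"
    by (simp only: sin_cos_squared_add) (simp add: power2_eq_square algebra_simps)
  then have "cos \<psi> = 1" using assms(1) by simp
  then obtain n :: int where n: "\<psi> = of_int n * 2 * pi"
    using cos_one_2pi_int by auto
  have "\<bar>\<psi>\<bar> < 2 * pi"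
    using arg_left_bounds[of mu] assms(3,4) by (auto simp: \<psi>_def)
  then have "\<bar>of_int n\<bar> * (2 * pi) < 1 * (2 * pi)"
    unfolding n by (simp add: abs_mult)
  then have "\<bar>real_of_int n\<bar> < 1"
    by (rule mult_right_less_imp_less) simp
  then have "n = 0" by linarith
  with n show "\<omega> = arg_left mu" by (simp add: \<psi>_def)
qed

section \<open>Square-summable grid functions and the time-stepping operator\<close>

lemma l2_seq_UNIV: "u \<in> l2_seq grid \<Longrightarrow> u \<in> l2_seq UNIV"
  by (simp add: l2_seq_def)

lemma l2_seq_iff: "u \<in> l2_seq grid \<longleftrightarrow> u \<in> l2_seq UNIV \<and> (\<forall>k. k \<notin> grid \<longrightarrow> u k = 0)"
  by (auto simp: l2_seq_def)

lemma l2_norm_nonneg: "l2_norm u \<ge> 0"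
  by (simp add: l2_norm_def infsum_nonneg)

lemma L2_set_le_l2_norm:
  assumes "u \<in> l2_seq UNIV" "finite J"
  shows "L2_set (\<lambda>k. cmod (u k)) J \<le> l2_norm u"
  unfolding L2_set_def l2_norm_def
  using assms by (intro real_sqrt_le_mono finite_sum_le_infsum) (auto simp: l2_seq_def)

lemma norm_le_l2_norm:
  assumes "u \<in> l2_seq UNIV"
  shows "cmod (u k) \<le> l2_norm u"
  using L2_set_le_l2_norm[OF assms, of "{k}"] by simp

text \<open>
  Bounding finite restrictions transfers the triangle inequality for finite sums, also for limits
  of partial sums, to square-summable sequences.
\<close>

lemma l2_seqI:
  assumes "\<And>J. finite J \<Longrightarrow> L2_set (\<lambda>k. cmod (u k)) J \<le> B"
  shows "u \<in> l2_seq UNIV" and "l2_norm u \<le> B"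
proof -
  have B: "B \<ge> 0" using assms[of "{}"] by simp
  have bound: "(\<Sum>k\<in>J. (cmod (u k))\<^sup>2) \<le> B\<^sup>2" if "finite J" for J
    using assms[OF that] unfolding L2_set_def by (rule sqrt_le_D)
  then have "(\<lambda>k. (cmod (u k))\<^sup>2) summable_on UNIV"
    by (intro nonneg_bdd_above_summable_on bdd_aboveI[of _ "B\<^sup>2"]) auto
  then show "u \<in> l2_seq UNIV" and "l2_norm u \<le> B"
    using infsum_le_finite_sums[of "\<lambda>k. (cmod (u k))\<^sup>2" UNIV "B\<^sup>2"] bound B
    by (auto simp: l2_seq_def l2_norm_def intro: real_le_lsqrt)
qed

lemma l2_seq_has_sum:
  "u \<in> l2_seq UNIV \<Longrightarrow> ((\<lambda>k. (cmod (u k))\<^sup>2) has_sum (l2_norm u)\<^sup>2) UNIV"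
  by (simp add: l2_seq_def l2_norm_def infsum_nonneg)

lemma l2_norm_eqI:
  assumes "((\<lambda>k. (cmod (u k))\<^sup>2) has_sum B\<^sup>2) UNIV" "B \<ge> 0"
  shows "u \<in> l2_seq UNIV" and "l2_norm u = B"
  using assms infsumI[OF assms(1)] by (auto simp: l2_seq_def l2_norm_def summable_on_def)

lemma l2_shift:
  assumes "u \<in> l2_seq UNIV"
  shows "(\<lambda>k. u (k - n)) \<in> l2_seq UNIV" and "l2_norm (\<lambda>k. u (k - n)) = l2_norm u"
proof -
  have "bij_betw (\<lambda>k. k - n) UNIV (UNIV :: int set)"
    by (rule bij_betwI[of _ _ _ "\<lambda>k. k + n"]) auto
  from has_sum_reindex_bij_betw[OF this, of "\<lambda>k. (cmod (u k))\<^sup>2"]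
  have "((\<lambda>k. (cmod (u (k - n)))\<^sup>2) has_sum (l2_norm u)\<^sup>2) UNIV"
    using l2_seq_has_sum[OF assms] by blast
  then show "(\<lambda>k. u (k - n)) \<in> l2_seq UNIV" and "l2_norm (\<lambda>k. u (k - n)) = l2_norm u"
    using l2_norm_eqI[OF _ l2_norm_nonneg] by auto
qed

lemma l2_scale:
  assumes "u \<in> l2_seq UNIV"
  shows "(\<lambda>k. c * u k) \<in> l2_seq UNIV" and "l2_norm (\<lambda>k. c * u k) = cmod c * l2_norm u"
proof -
  have "((\<lambda>k. (cmod (c * u k))\<^sup>2) has_sum (cmod c * l2_norm u)\<^sup>2) UNIV"
    using has_sum_cmult_right[OF l2_seq_has_sum[OF assms], of "(cmod c)\<^sup>2"]
    by (simp add: norm_mult power_mult_distrib)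
  then show "(\<lambda>k. c * u k) \<in> l2_seq UNIV" and "l2_norm (\<lambda>k. c * u k) = cmod c * l2_norm u"
    using l2_norm_eqI[of "\<lambda>k. c * u k" "cmod c * l2_norm u"] l2_norm_nonneg by auto
qed

lemma l2_add:
  assumes u: "u \<in> l2_seq UNIV" and v: "v \<in> l2_seq UNIV"
  shows "(\<lambda>k. u k + v k) \<in> l2_seq UNIV" and "l2_norm (\<lambda>k. u k + v k) \<le> l2_norm u + l2_norm v"
proof -
  have "L2_set (\<lambda>k. cmod (u k + v k)) J \<le> l2_norm u + l2_norm v" if "finite J" for J
  proof -
    have "L2_set (\<lambda>k. cmod (u k + v k)) J \<le> L2_set (\<lambda>k. cmod (u k) + cmod (v k)) J"
      by (intro L2_set_mono) (auto intro: norm_triangle_ineq)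
    also have "\<dots> \<le> L2_set (\<lambda>k. cmod (u k)) J + L2_set (\<lambda>k. cmod (v k)) J"
      by (rule L2_set_triangle_ineq)
    finally show ?thesis
      using L2_set_le_l2_norm[OF u that] L2_set_le_l2_norm[OF v that] by linarith
  qed
  from l2_seqI[OF this]
  show "(\<lambda>k. u k + v k) \<in> l2_seq UNIV" and "l2_norm (\<lambda>k. u k + v k) \<le> l2_norm u + l2_norm v"
    by auto
qed

lemma l2_diff:
  assumes "u \<in> l2_seq UNIV" "v \<in> l2_seq UNIV"
  shows "(\<lambda>k. u k - v k) \<in> l2_seq UNIV"
  using l2_add(1)[OF assms(1) l2_scale(1)[OF assms(2), of "-1"]] by simp

lemma l2_time_step_op:
  assumes "u \<in> l2_seq UNIV"
  shows "time_step_op a u \<in> l2_seq UNIV"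
  unfolding time_step_op_def by (intro l2_diff l2_scale(1) l2_shift(1) assms)

text \<open>
  The shift is an isometry, so \<open>d = (I - \<mu> S) d + \<mu> S d\<close> gives \<open>\<parallel>d\<parallel> \<le> \<parallel>(I - \<mu> S) d\<parallel> + |\<mu>| \<parallel>d\<parallel>\<close>.
\<close>

lemma time_step_op_bounded_below:
  assumes d: "d \<in> l2_seq UNIV"
  shows "(1 - cmod mu) * l2_norm d \<le> l2_norm (time_step_op mu d)"
proof -
  have "l2_norm d = l2_norm (\<lambda>k. time_step_op mu d k + mu * d (k - 1))"
    by (simp add: time_step_op_def)
  also have "\<dots> \<le> l2_norm (time_step_op mu d) + cmod mu * l2_norm d"
    using l2_add(2)[OF l2_time_step_op[OF d] l2_scale(1)[OF l2_shift(1)[OF d]], of mu mu 1]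
    by (simp only: l2_scale(2)[OF l2_shift(1)[OF d]] l2_shift(2)[OF d])
  finally show ?thesis by (simp add: algebra_simps)
qed

lemma time_step_op_inj:
  assumes "cmod mu < 1" "d \<in> l2_seq UNIV" "d' \<in> l2_seq UNIV"
    and eq: "time_step_op mu d = time_step_op mu d'"
  shows "d = d'"
proof
  fix k
  define e where "e = (\<lambda>k. d k - d' k)"
  have e: "e \<in> l2_seq UNIV" unfolding e_def by (intro l2_diff assms)
  have "time_step_op mu e = (\<lambda>_. 0)"
    using fun_cong[OF eq] by (auto simp: e_def time_step_op_def algebra_simps)
  then have "(1 - cmod mu) * l2_norm e \<le> 0"
    using time_step_op_bounded_below[OF e, of mu] by (simp add: l2_norm_def)
  then have "l2_norm e \<le> 0"
    using assms(1) by (simp add: mult_le_0_iff)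
  then have "cmod (e k) \<le> 0"
    using norm_le_l2_norm[OF e, of k] by linarith
  then show "d k = d' k" by (simp add: e_def)
qed

text \<open>
  The Neumann series \<open>\<Sum>n. \<mu>\<^sup>n S\<^sup>n h\<close> is a solution. It only looks backward in time, so it
  vanishes wherever the whole past of \<open>h\<close> does, which keeps the half-line invariant.
\<close>

lemma time_step_op_surj:
  assumes mu: "cmod mu < 1" and h: "h \<in> l2_seq grid" and grid: "grid \<in> {UNIV, {0..}}"
  shows "h \<in> time_step_op mu ` l2_seq grid"
proof -
  have hU: "h \<in> l2_seq UNIV" using h by (rule l2_seq_UNIV)
  define g where "g = (\<lambda>k. \<Sum>n. mu ^ n * h (k - int n))"
  have summable: "summable (\<lambda>n. mu ^ n * h (k - int n))" for k
  proof (rule summable_comparison_test')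
    show "summable (\<lambda>n. cmod mu ^ n * l2_norm h)"
      using mu by (intro summable_mult2 summable_geometric) simp
    show "norm (mu ^ n * h (k - int n)) \<le> cmod mu ^ n * l2_norm h" for n
      using norm_le_l2_norm[OF hU, of "k - int n"]
      by (simp add: norm_mult norm_power mult_left_mono)
  qed
  have step: "g k = h k + mu * g (k - 1)" for k
  proof -
    have "(\<Sum>n. mu ^ Suc n * h (k - int (Suc n))) = mu * g (k - 1)"
      unfolding g_def suminf_mult[OF summable, symmetric]
      by (intro suminf_cong) (simp add: algebra_simps)
    then show ?thesis
      using suminf_split_head[OF summable, of k] by (simp add: g_def)
  qed
  have partial: "L2_set (\<lambda>k. cmod (\<Sum>n<N. mu ^ n * h (k - int n))) J \<le> (\<Sum>n<N. cmod mu ^ n * l2_norm h)"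
    if "finite J" for J N
  proof (induction N)
    case 0
    then show ?case by (simp add: L2_set_0')
  next
    case (Suc N)
    have "L2_set (\<lambda>k. cmod (\<Sum>n<Suc N. mu ^ n * h (k - int n))) J
        \<le> L2_set (\<lambda>k. cmod (\<Sum>n<N. mu ^ n * h (k - int n)) + cmod mu ^ N * cmod (h (k - int N))) J"
      by (intro L2_set_mono) (auto intro!: norm_triangle_le simp: norm_mult norm_power)
    also have "\<dots> \<le> L2_set (\<lambda>k. cmod (\<Sum>n<N. mu ^ n * h (k - int n))) J
        + cmod mu ^ N * L2_set (\<lambda>k. cmod (h (k - int N))) J"
      unfolding L2_set_right_distrib[OF zero_le_power[OF norm_ge_zero]]
      by (rule L2_set_triangle_ineq)
    also have "L2_set (\<lambda>k. cmod (h (k - int N))) J \<le> l2_norm h"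
      using L2_set_le_l2_norm[OF l2_shift(1)[OF hU] that] l2_shift(2)[OF hU] by metis
    finally show ?case using Suc.IH by (simp add: mult_left_mono)
  qed
  have "L2_set (\<lambda>k. cmod (g k)) J \<le> (\<Sum>n. cmod mu ^ n * l2_norm h)" if "finite J" for J
  proof (rule LIMSEQ_le)
    have "(\<lambda>N. \<Sum>n<N. mu ^ n * h (k - int n)) \<longlonglongrightarrow> g k" for k
      unfolding g_def by (rule summable_LIMSEQ[OF summable])
    then show "(\<lambda>N. L2_set (\<lambda>k. cmod (\<Sum>n<N. mu ^ n * h (k - int n))) J) \<longlonglongrightarrow> L2_set (\<lambda>k. cmod (g k)) J"
      unfolding L2_set_def by (intro tendsto_intros)
    show "(\<lambda>N. \<Sum>n<N. cmod mu ^ n * l2_norm h) \<longlonglongrightarrow> (\<Sum>n. cmod mu ^ n * l2_norm h)"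
      using mu by (intro summable_LIMSEQ summable_mult2 summable_geometric) simp
    show "\<exists>N0. \<forall>N\<ge>N0. L2_set (\<lambda>k. cmod (\<Sum>n<N. mu ^ n * h (k - int n))) J
        \<le> (\<Sum>n<N. cmod mu ^ n * l2_norm h)"
      using partial[OF that] by blast
  qed
  then have "g \<in> l2_seq UNIV" by (rule l2_seqI)
  moreover have "g k = 0" if "k \<notin> grid" for k
  proof -
    have "h (k - int n) = 0" for n
      using h grid that by (auto simp: l2_seq_def)
    then show ?thesis by (simp add: g_def)
  qed
  ultimately have "g \<in> l2_seq grid" by (simp add: l2_seq_iff[of g grid])
  moreover have "time_step_op mu g = h"
    unfolding time_step_op_def by (rule ext, subst step) simp
  ultimately show ?thesis by blast
qed

section \<open>Extension from coarse points to blocks\<close>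

text \<open>
  Block-wise propagation of coarse values by the fine time step; for \<open>\<lambda> = 0\<close> it is the injection
  of coarse values, because \<open>0\<^sup>0 = 1\<close>.
\<close>

definition block_ext :: "nat \<Rightarrow> complex \<Rightarrow> (int \<Rightarrow> complex) \<Rightarrow> (int \<Rightarrow> complex)" where
  "block_ext m lam w = (\<lambda>k. lam ^ nat (k mod int m) * w (k div int m))"

lemma block_index:
  assumes "m \<ge> 1"
  shows "(int m * j) div int m = j" "(int m * j) mod int m = 0"
    "(int m * j - 1) div int m = j - 1" "(int m * j - 1) mod int m = int m - 1"
proof -
  have "int m * j - 1 = int m * (j - 1) + (int m - 1)" by (simp add: algebra_simps)
  from int_div_pos_eq[OF this] int_mod_pos_eq[OF this]
  show "(int m * j - 1) div int m = j - 1" "(int m * j - 1) mod int m = int m - 1"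
    using assms by auto
qed (use assms in auto)

lemma F_relax_op_eq: "F_relax_op m lam u = block_ext m lam (restrict_op m u)"
  by (simp add: F_relax_op_def block_ext_def restrict_op_def)

lemma restrict_block_ext: "m \<ge> 1 \<Longrightarrow> restrict_op m (block_ext m lam w) = w"
  by (simp add: restrict_op_def block_ext_def)

text \<open>
  The integers split into the residue classes modulo \<open>m\<close>, and on the class of \<open>r\<close> the extension
  is a copy of \<open>w\<close> scaled by \<open>\<lambda>\<^sup>r\<close>.
\<close>

lemma block_ext_l2:
  assumes m: "m \<ge> 1" and w: "w \<in> l2_seq UNIV"
  shows "block_ext m lam w \<in> l2_seq UNIV"
    and "l2_norm (block_ext m lam w) = sqrt (\<Sum>r<m. cmod lam ^ (2 * r)) * l2_norm w"
proof -
  define B where "B = (\<lambda>r::nat. range (\<lambda>j. int m * j + int r))"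
  have "((\<lambda>k. (cmod (block_ext m lam w k))\<^sup>2) has_sum cmod lam ^ (2 * r) * (l2_norm w)\<^sup>2) (B r)"
    if "r \<in> {..<m}" for r
  proof -
    have inj: "inj (\<lambda>j. int m * j + int r)"
      using m by (auto intro: injI)
    have "cmod (block_ext m lam w (int m * j + int r)) = cmod lam ^ r * cmod (w j)" for j
      using that by (simp add: block_ext_def norm_mult norm_power)
    then show ?thesis
      unfolding B_def has_sum_reindex[OF inj] o_def
      using has_sum_cmult_right[OF l2_seq_has_sum[OF w], of "cmod lam ^ (2 * r)"]
      by (simp add: power_mult_distrib power_mult[symmetric] mult.commute)
  qed
  moreover have "B r \<inter> B s = {}" if "r \<in> {..<m}" "s \<in> {..<m}" "r \<noteq> s" for r s
  proof -
    have "k mod int m = int t" if "k \<in> B t" "t < m" for k t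
      using that by (auto simp: B_def)
    from this[of _ r] this[of _ s] show ?thesis
      using that by (metis disjoint_iff lessThan_iff of_nat_eq_iff)
  qed
  ultimately have "((\<lambda>k. (cmod (block_ext m lam w k))\<^sup>2)
      has_sum (\<Sum>r<m. cmod lam ^ (2 * r) * (l2_norm w)\<^sup>2)) (\<Union>r<m. B r)"
    by (intro sum_has_sum) auto
  moreover have "(\<Union>r<m. B r) = UNIV"
  proof -
    have "k \<in> B (nat (k mod int m))" "nat (k mod int m) < m" for k
      using m by (auto simp: B_def intro!: image_eqI[of _ _ "k div int m"] simp: nat_less_iff)
    then show ?thesis by blast
  qed
  ultimately have "((\<lambda>k. (cmod (block_ext m lam w k))\<^sup>2)
      has_sum (sqrt (\<Sum>r<m. cmod lam ^ (2 * r)) * l2_norm w)\<^sup>2) UNIV"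
    by (simp add: power_mult_distrib sum_nonneg sum_distrib_right)
  then show "block_ext m lam w \<in> l2_seq UNIV"
    and "l2_norm (block_ext m lam w) = sqrt (\<Sum>r<m. cmod lam ^ (2 * r)) * l2_norm w"
    using l2_norm_eqI[of "block_ext m lam w" "sqrt (\<Sum>r<m. cmod lam ^ (2 * r)) * l2_norm w"]
    by (auto simp: l2_norm_nonneg sum_nonneg)
qed

lemma block_ext_grid:
  assumes "m \<ge> 1" "w \<in> l2_seq grid" "grid \<in> {UNIV, {0..}}"
  shows "block_ext m lam w \<in> l2_seq grid"
proof -
  have "w (k div int m) = 0" if "k \<notin> grid" for k
    using assms that div_neg_pos_less0[of k "int m"] by (auto simp: l2_seq_def)
  then show ?thesis
    unfolding l2_seq_iff[of _ grid] using block_ext_l2(1)[OF assms(1) l2_seq_UNIV[OF assms(2)]]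
    by (simp add: block_ext_def)
qed

lemma restrict_op_l2:
  assumes m: "m \<ge> 1" and u: "u \<in> l2_seq UNIV"
  shows "restrict_op m u \<in> l2_seq UNIV" and "l2_norm (restrict_op m u) \<le> l2_norm u"
proof -
  have "L2_set (\<lambda>j. cmod (restrict_op m u j)) J \<le> l2_norm u" if "finite J" for J
  proof -
    have "inj_on (\<lambda>j. int m * j) J" using m by (auto intro: inj_onI)
    then have "L2_set (\<lambda>j. cmod (restrict_op m u j)) J = L2_set (\<lambda>k. cmod (u k)) ((\<lambda>j. int m * j) ` J)"
      by (simp add: L2_set_def restrict_op_def sum.reindex)
    then show ?thesis using L2_set_le_l2_norm[OF u] that by simp
  qed
  from l2_seqI[OF this]
  show "restrict_op m u \<in> l2_seq UNIV" and "l2_norm (restrict_op m u) \<le> l2_norm u" by auto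
qed

lemma CF_relax_block_ext:
  assumes "m \<ge> 1"
  shows "CF_relax_op m lam (block_ext m lam w) = block_ext m lam (\<lambda>j. lam ^ m * w (j - 1))"
proof -
  have "nat (int m - 1) = m - 1" using assms by simp
  moreover have "lam * lam ^ (m - 1) = lam ^ m" using assms by (simp add: power_eq_if)
  ultimately show ?thesis
    unfolding CF_relax_op_def block_ext_def block_index[OF assms] by (auto simp: mult_ac)
qed

lemma CF_relax_power_block_ext:
  assumes "m \<ge> 1"
  shows "(CF_relax_op m lam ^^ nu) (block_ext m lam w)
    = block_ext m lam (\<lambda>j. lam ^ (m * nu) * w (j - int nu))"
  by (induction nu) (simp_all add: CF_relax_block_ext[OF assms] power_add algebra_simps)

lemma restrict_time_step_block_ext:
  assumes "m \<ge> 1"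
  shows "restrict_op m (time_step_op lam (block_ext m lam w)) = time_step_op (lam ^ m) w"
proof -
  have "nat (int m - 1) = m - 1" using assms by simp
  moreover have "lam * lam ^ (m - 1) = lam ^ m" using assms by (simp add: power_eq_if)
  ultimately show ?thesis
    unfolding restrict_op_def time_step_op_def block_ext_def block_index[OF assms]
    by (auto simp: mult.assoc[symmetric])
qed

section \<open>The operator norm of the error propagator\<close>

text \<open>
  After relaxation the error is the extension of \<open>w = \<lambda>\<^bsup>m\<nu>\<^esup> S\<^sup>\<nu> u\<close>, with \<open>u\<close> read at the coarse
  points, and the coarse correction subtracts the solution \<open>g\<close> of \<open>(I - \<mu> S) g = (I - \<lambda>\<^sup>m S) w\<close>.
  Hence \<open>d = w - g\<close> satisfies \<open>(I - \<mu> S) d = (\<lambda>\<^sup>m - \<mu>) S w\<close>.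
\<close>

lemma error_propagator_coarse_form:
  assumes m: "m \<ge> 1" and mu: "cmod mu < 1" and grid: "grid \<in> {UNIV, {0..}}"
    and u: "u \<in> l2_seq grid"
  obtains d where "d \<in> l2_seq grid"
    and "error_propagator grid m lam mu nu u = block_ext m lam d"
    and "time_step_op mu d
      = (\<lambda>j. lam ^ (m * nu) * (lam ^ m - mu) * restrict_op m u (j - (int nu + 1)))"
proof -
  define w where "w = (\<lambda>j. lam ^ (m * nu) * restrict_op m u (j - int nu))"
  have "restrict_op m u j = 0" if "j \<notin> grid" for j
    using grid u that m mult_pos_neg[of "int m" j] by (auto simp: restrict_op_def l2_seq_def)
  then have "w j = 0" if "j \<notin> grid" for j
    using grid that by (auto simp: w_def)
  moreover have "w \<in> l2_seq UNIV"
    unfolding w_def by (intro l2_scale(1) l2_shift(1) restrict_op_l2(1)[OF m] l2_seq_UNIV[OF u])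
  ultimately have w: "w \<in> l2_seq grid" by (simp add: l2_seq_iff[of w grid])
  have "time_step_op (lam ^ m) w j = 0" if "j \<notin> grid" for j
    using w grid that by (auto simp: l2_seq_def time_step_op_def)
  then have h: "time_step_op (lam ^ m) w \<in> l2_seq grid"
    using l2_time_step_op[OF l2_seq_UNIV[OF w]] by (simp add: l2_seq_iff[of _ grid])
  define g where "g = inv_into (l2_seq grid) (time_step_op mu) (time_step_op (lam ^ m) w)"
  have g: "g \<in> l2_seq grid" "time_step_op mu g = time_step_op (lam ^ m) w"
    unfolding g_def using time_step_op_surj[OF mu h grid] by (simp_all add: inv_into_into f_inv_into_f)
  define d where "d = (\<lambda>j. w j - g j)"
  have "d \<in> l2_seq grid"
    unfolding l2_seq_iff[of d grid] d_def
    using l2_diff[OF l2_seq_UNIV[OF w] l2_seq_UNIV[OF g(1)]] w g(1) by (auto simp: l2_seq_def)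
  moreover have "error_propagator grid m lam mu nu u = block_ext m lam d"
  proof -
    have "restrict_op m (coarse_correction_op grid m lam mu (block_ext m lam w)) = d"
      unfolding coarse_correction_op_def restrict_time_step_block_ext[OF m] g_def[symmetric]
      using m by (auto simp: restrict_op_def interp_op_def block_ext_def d_def)
    then show ?thesis
      by (simp add: error_propagator_def F_relax_op_eq CF_relax_power_block_ext[OF m] w_def[symmetric])
  qed
  moreover have "time_step_op mu d
      = (\<lambda>j. lam ^ (m * nu) * (lam ^ m - mu) * restrict_op m u (j - (int nu + 1)))"
  proof
    fix j
    have "time_step_op mu d j = time_step_op mu w j - time_step_op mu g j"
      by (simp add: time_step_op_def d_def algebra_simps)
    also have "\<dots> = (lam ^ m - mu) * w (j - 1)"
      unfolding g(2) by (simp add: time_step_op_def algebra_simps)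
    finally show "time_step_op mu d j = lam ^ (m * nu) * (lam ^ m - mu) * restrict_op m u (j - (int nu + 1))"
      by (simp add: w_def algebra_simps)
  qed
  ultimately show thesis by (rule that)
qed

text \<open>
  On the Fourier mode with frequency \<open>arg \<mu>\<close> the operator \<open>I - \<mu> S\<close> is multiplication by
  \<open>1 - |\<mu>|\<close>. Cutting the mode off to \<open>N\<close> points disturbs this at the two ends only, at a cost
  that does not grow with \<open>N\<close>.
\<close>

lemma truncated_mode:
  fixes N :: nat
  assumes N: "N \<ge> 1" and mu: "cmod mu < 1"
  obtains d where "d \<in> l2_seq {0..}" "l2_norm d = sqrt (real N)"
    "(l2_norm (time_step_op mu d))\<^sup>2 \<le> real N * (1 - cmod mu)\<^sup>2 + 2"
proof -
  define d where "d = (\<lambda>j::int. if 0 \<le> j \<and> j < int N then cis (of_int j * Arg mu) else 0)"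
  have "((\<lambda>j. (cmod (d j))\<^sup>2) has_sum (sqrt (real N))\<^sup>2) UNIV"
  proof (rule has_sum_finite_neutralI[of "{0..<int N}"])
    have "(\<Sum>j\<in>{0..<int N}. (cmod (d j))\<^sup>2) = (\<Sum>j\<in>{0..<int N}. 1)"
      by (intro sum.cong) (auto simp: d_def)
    then show "(sqrt (real N))\<^sup>2 = (\<Sum>j\<in>{0..<int N}. (cmod (d j))\<^sup>2)"
      by simp
  qed (auto simp: d_def)
  from l2_norm_eqI[OF this] have d: "d \<in> l2_seq UNIV" and norm_d: "l2_norm d = sqrt (real N)"
    by auto
  define w where "w = time_step_op mu d"
  have w0: "cmod (w 0) \<le> 1" using N by (simp add: w_def time_step_op_def d_def)
  have wN: "cmod (w (int N)) \<le> 1"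
    using N mu by (simp add: w_def time_step_op_def d_def norm_mult)
  have w_mid: "cmod (w j) = 1 - cmod mu" if "j \<in> {1..<int N}" for j
  proof -
    have "w j = cis (of_int j * Arg mu) - rcis (cmod mu) (Arg mu) * cis (of_int (j - 1) * Arg mu)"
      using that by (simp add: w_def time_step_op_def d_def rcis_cmod_Arg)
    also have "rcis (cmod mu) (Arg mu) * cis (of_int (j - 1) * Arg mu)
        = of_real (cmod mu) * cis (of_int j * Arg mu)"
      by (simp add: rcis_def cis_mult mult.assoc algebra_simps)
    finally have "w j = of_real (1 - cmod mu) * cis (of_int j * Arg mu)"
      by (simp add: algebra_simps)
    then show ?thesis using mu by (simp only: norm_mult norm_of_real norm_cis)  simp
  qed
  have "((\<lambda>j. (cmod (w j))\<^sup>2) has_sum (\<Sum>j\<in>insert 0 (insert (int N) {1..<int N}). (cmod (w j))\<^sup>2)) UNIV"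
    by (rule has_sum_finite_neutralI[of "insert 0 (insert (int N) {1..<int N})"])
      (auto simp: w_def time_step_op_def d_def)
  then have "(l2_norm w)\<^sup>2 = (\<Sum>j\<in>insert 0 (insert (int N) {1..<int N}). (cmod (w j))\<^sup>2)"
    using has_sum_unique[OF l2_seq_has_sum[OF l2_time_step_op[OF d], of mu]] by (simp add: w_def)
  also have "\<dots> = (cmod (w 0))\<^sup>2 + (cmod (w (int N)))\<^sup>2 + (\<Sum>j\<in>{1..<int N}. (cmod (w j))\<^sup>2)"
    using N by simp
  also have "(\<Sum>j\<in>{1..<int N}. (cmod (w j))\<^sup>2) = real (N - 1) * (1 - cmod mu)\<^sup>2"
    using N by (simp add: w_mid nat_diff_distrib)
  also have "(cmod (w 0))\<^sup>2 + (cmod (w (int N)))\<^sup>2 + real (N - 1) * (1 - cmod mu)\<^sup>2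
      \<le> 1 + 1 + real N * (1 - cmod mu)\<^sup>2"
    using w0 wN by (intro add_mono mult_right_mono) (auto simp: power_le_one)
  finally show thesis
    using d norm_d by (intro that[of d]) (auto simp: l2_seq_iff[of d "{0..}"] w_def, auto simp: d_def)
qed

lemma linear_growth_le:
  fixes a b c :: real
  assumes "\<And>N::nat. N \<ge> 1 \<Longrightarrow> a * real N \<le> b * real N + c"
  shows "a \<le> b"
proof (rule ccontr)
  assume "\<not> a \<le> b"
  then have pos: "a - b > 0" by simp
  obtain N :: nat where N: "c / (a - b) < real N" using reals_Archimedean2 by blast
  have "c < (a - b) * real N" using N pos by (simp add: field_simps)
  also have "\<dots> \<le> (a - b) * real (Suc N)" using pos by (intro mult_left_mono) auto
  also have "\<dots> \<le> c" using assms[of "Suc N"] by (simp add: algebra_simps)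
  finally show False by simp
qed

text \<open>
  For the lower bound the source is \<open>(I - \<mu> S) d\<^sub>0\<close> with \<open>d\<^sub>0\<close> a truncated mode. By uniqueness the
  error propagator returns the extension of a shifted multiple of \<open>d\<^sub>0\<close>, and letting the length
  of the mode grow makes the end effects negligible.
\<close>

theorem l2_opnorm_error_propagator:
  assumes m: "m \<ge> 1" and mu: "cmod mu < 1" and grid: "grid \<in> {UNIV, {0..}}"
  shows "l2_opnorm grid (error_propagator grid m lam mu nu)
    = cmod lam ^ (m * nu) * cmod (lam ^ m - mu) * sqrt (\<Sum>r<m. cmod lam ^ (2 * r)) / (1 - cmod mu)"
proof -
  define c where "c = lam ^ (m * nu) * (lam ^ m - mu)"
  define s where "s = sqrt (\<Sum>r<m. cmod lam ^ (2 * r))"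
  have s: "s \<ge> 0" by (simp add: s_def sum_nonneg)
  define K where "K = cmod c * s / (1 - cmod mu)"
  have K: "K \<ge> 0" using s mu by (simp add: K_def)
  let ?E = "error_propagator grid m lam mu nu"
  have upper: "?E u \<in> l2_seq grid \<and> l2_norm (?E u) \<le> K * l2_norm u" if u: "u \<in> l2_seq grid" for u
  proof -
    obtain d where d: "d \<in> l2_seq grid" "?E u = block_ext m lam d"
      and eq: "time_step_op mu d = (\<lambda>j. c * restrict_op m u (j - (int nu + 1)))"
      using error_propagator_coarse_form[OF m mu grid u, of lam nu] unfolding c_def by metis
    note u' = restrict_op_l2[OF m l2_seq_UNIV[OF u]]
    have "(1 - cmod mu) * l2_norm d \<le> cmod c * l2_norm (restrict_op m u)"
      using time_step_op_bounded_below[OF l2_seq_UNIV[OF d(1)], of mu]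
      unfolding eq l2_scale(2)[OF l2_shift(1)[OF u'(1)]] l2_shift(2)[OF u'(1)] .
    also have "\<dots> \<le> cmod c * l2_norm u"
      using u'(2) by (intro mult_left_mono) auto
    finally have "l2_norm d \<le> cmod c * l2_norm u / (1 - cmod mu)"
      using mu by (simp add: field_simps)
    then have "s * l2_norm d \<le> s * (cmod c * l2_norm u / (1 - cmod mu))"
      using s by (rule mult_left_mono)
    then show ?thesis
      unfolding d(2) block_ext_l2(2)[OF m l2_seq_UNIV[OF d(1)]] s_def[symmetric]
      using block_ext_grid[OF m d(1) grid] by (simp add: K_def mult_ac)
  qed
  have lower: "K \<le> C"
    if C: "C \<ge> 0" and bound: "\<And>u. u \<in> l2_seq grid \<Longrightarrow> l2_norm (?E u) \<le> C * l2_norm u" for C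
  proof -
    have "(cmod c * s)\<^sup>2 * real N \<le> C\<^sup>2 * (1 - cmod mu)\<^sup>2 * real N + 2 * C\<^sup>2" if N: "N \<ge> 1" for N
    proof -
      obtain d0 where d0: "d0 \<in> l2_seq {0..}" "l2_norm d0 = sqrt (real N)"
        and w0_norm: "(l2_norm (time_step_op mu d0))\<^sup>2 \<le> real N * (1 - cmod mu)\<^sup>2 + 2"
        using truncated_mode[OF N mu] by blast
      note d0U = l2_seq_UNIV[OF d0(1)]
      define w0 where "w0 = time_step_op mu d0"
      have w0U: "w0 \<in> l2_seq UNIV" unfolding w0_def by (rule l2_time_step_op[OF d0U])
      have "w0 j = 0" if "j \<notin> grid" for j
        using that grid d0(1) by (auto simp: w0_def time_step_op_def l2_seq_def)
      then have w0: "w0 \<in> l2_seq grid" using w0U by (simp add: l2_seq_iff[of w0 grid])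
      \<comment> \<open>Zero between the coarse points, so that no norm is wasted on values that F-relaxation
        discards.\<close>
      define u where "u = block_ext m 0 w0"
      have u: "u \<in> l2_seq grid" unfolding u_def by (rule block_ext_grid[OF m w0 grid])
      have "(\<Sum>r<m. cmod 0 ^ (2 * r)) = (1 :: real)"
        using m by (simp add: power_0_left)
      then have u_norm: "l2_norm u = l2_norm w0"
        unfolding u_def block_ext_l2(2)[OF m w0U] by simp
      obtain d where d: "d \<in> l2_seq grid" "?E u = block_ext m lam d"
        and eq: "time_step_op mu d = (\<lambda>j. c * restrict_op m u (j - (int nu + 1)))"
        using error_propagator_coarse_form[OF m mu grid u, of lam nu] unfolding c_def by metis
      \<comment> \<open>\<open>I - \<mu> S\<close> commutes with shifts, so the solution for the source \<open>w0\<close> is known explicitly.\<close>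
      define d1 where "d1 = (\<lambda>j. c * d0 (j - (int nu + 1)))"
      have d1: "d1 \<in> l2_seq UNIV" unfolding d1_def by (intro l2_scale(1) l2_shift(1) d0U)
      have d1_norm: "l2_norm d1 = cmod c * sqrt (real N)"
        unfolding d1_def l2_scale(2)[OF l2_shift(1)[OF d0U]] l2_shift(2)[OF d0U] d0(2) ..
      have "time_step_op mu d = time_step_op mu d1"
        unfolding eq u_def restrict_block_ext[OF m] w0_def d1_def
        by (rule ext) (simp add: time_step_op_def algebra_simps)
      then have "d = d1" by (rule time_step_op_inj[OF mu l2_seq_UNIV[OF d(1)] d1])
      then have "l2_norm (?E u) = s * (cmod c * sqrt (real N))"
        unfolding d(2) block_ext_l2(2)[OF m l2_seq_UNIV[OF d(1)]] s_def[symmetric] by (simp add: d1_norm)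
      then have "s * (cmod c * sqrt (real N)) \<le> C * l2_norm w0"
        using bound[OF u] u_norm by simp
      then have "(s * (cmod c * sqrt (real N)))\<^sup>2 \<le> (C * l2_norm w0)\<^sup>2"
        using s by (intro power_mono) auto
      also have "\<dots> \<le> C\<^sup>2 * (real N * (1 - cmod mu)\<^sup>2 + 2)"
        unfolding power_mult_distrib using w0_norm by (intro mult_left_mono) (auto simp: w0_def)
      finally show ?thesis by (simp add: power_mult_distrib algebra_simps)
    qed
    then have "(cmod c * s)\<^sup>2 \<le> C\<^sup>2 * (1 - cmod mu)\<^sup>2"
      by (rule linear_growth_le)
    then have "cmod c * s \<le> C * (1 - cmod mu)"
      unfolding power_mult_distrib[of C, symmetric]
      by (rule power2_le_imp_le) (use C mu in simp)
    then show "K \<le> C" using mu by (simp add: K_def pos_divide_le_eq)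
  qed
  have "l2_opnorm grid ?E = K"
    unfolding l2_opnorm_def using upper lower K by (intro cInf_eq_minimum) auto
  then show ?thesis by (simp add: K_def c_def s_def norm_mult norm_power mult_ac)
qed

section \<open>The two-level convergence factor\<close>

theorem theorem3:
  fixes m nu :: nat and lam mu :: complex
  assumes "m \<ge> 1" and "cmod lam < 1" and "cmod mu < 1"
  shows "(\<forall>grid\<in>{UNIV, {0..}}.
            l2_opnorm grid (error_propagator grid m lam mu nu)
            = (SUP \<theta>\<in>low_freqs m. mat_norm2 (error_symbol m lam mu nu \<theta>))) \<and>
         (SUP \<theta>\<in>low_freqs m. mat_norm2 (error_symbol m lam mu nu \<theta>))
            = cmod lam ^ (m * nu) * (cmod (lam ^ m - mu) / (1 - cmod mu))
              * sqrt ((1 - cmod lam ^ (2 * m)) / (1 - (cmod lam)\<^sup>2)) \<and>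
         is_arg_max (\<lambda>\<theta>. mat_norm2 (error_symbol m lam mu nu \<theta>))
            (\<lambda>\<theta>. \<theta> \<in> low_freqs m) (arg_left mu / real m) \<and>
         (mu \<noteq> 0 \<and> lam ^ m \<noteq> mu \<and> (lam \<noteq> 0 \<or> nu = 0) \<longrightarrow>
            (\<forall>\<theta>. is_arg_max (\<lambda>\<theta>. mat_norm2 (error_symbol m lam mu nu \<theta>))
                   (\<lambda>\<theta>. \<theta> \<in> low_freqs m) \<theta>
                 \<longrightarrow> \<theta> = arg_left mu / real m))"
proof -
  define K where "K = cmod lam ^ (m * nu) * cmod (lam ^ m - mu) * sqrt (\<Sum>r<m. cmod lam ^ (2 * r))"
  define N where "N = (\<lambda>\<theta>. mat_norm2 (error_symbol m lam mu nu \<theta>))"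
  define \<theta>\<^sub>0 where "\<theta>\<^sub>0 = arg_left mu / real m"
  have N_eq: "N \<theta> = K / cmod (1 - mu * cis (- (real m * \<theta>)))" for \<theta>
  proof -
    interpret two_level_symbol m lam \<theta>
      using assms by unfold_locales
    show ?thesis
      using mat_norm2_error_symbol[OF assms(3), of nu] by (simp add: N_def K_def)
  qed
  have K: "K \<ge> 0"
    by (simp add: K_def sum_nonneg)
  have m_\<theta>\<^sub>0: "real m * \<theta>\<^sub>0 = arg_left mu"
    using assms(1) by (simp add: \<theta>\<^sub>0_def)
  have in_low: "\<theta> \<in> low_freqs m \<longleftrightarrow> - pi \<le> real m * \<theta> \<and> real m * \<theta> < pi" for \<theta>
    using assms(1) by (auto simp: low_freqs_def field_simps)
  have \<theta>\<^sub>0_low: "\<theta>\<^sub>0 \<in> low_freqs m"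
    unfolding in_low m_\<theta>\<^sub>0 using arg_left_bounds by simp
  have "1 - mu * cis (- arg_left mu) = of_real (1 - cmod mu)"
    by (simp add: mult_cis_arg_left)
  then have "cmod (1 - mu * cis (- arg_left mu)) = 1 - cmod mu"
    using assms(3) by (simp only: norm_of_real)
  then have N_\<theta>\<^sub>0: "N \<theta>\<^sub>0 = K / (1 - cmod mu)"
    by (simp add: N_eq m_\<theta>\<^sub>0)
  have N_le: "N \<theta> \<le> N \<theta>\<^sub>0" for \<theta>
  proof -
    have "1 - cmod mu \<le> cmod (1 - mu * cis (- (real m * \<theta>)))"
      using norm_one_minus_ge[of "mu * cis (- (real m * \<theta>))"] by (simp add: norm_mult)
    then have "K / cmod (1 - mu * cis (- (real m * \<theta>))) \<le> K / (1 - cmod mu)"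
      using K assms(3) by (intro frac_le) simp_all
    then show ?thesis
      by (simp only: N_eq[of \<theta>] N_\<theta>\<^sub>0)
  qed
  have sup: "(SUP \<theta>\<in>low_freqs m. N \<theta>) = K / (1 - cmod mu)"
  proof (rule cSup_eq_maximum)
    show "K / (1 - cmod mu) \<in> N ` low_freqs m"
      unfolding N_\<theta>\<^sub>0[symmetric] using \<theta>\<^sub>0_low by (rule imageI)
    show "x \<le> K / (1 - cmod mu)" if "x \<in> N ` low_freqs m" for x
      using that N_le unfolding N_\<theta>\<^sub>0 by blast
  qed
  have "(cmod lam)\<^sup>2 < 1"
    using assms(2) by (simp add: power_less_one_iff)
  then have geometric: "(\<Sum>r<m. cmod lam ^ (2 * r)) = (1 - cmod lam ^ (2 * m)) / (1 - (cmod lam)\<^sup>2)"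
    unfolding power_mult using sum_gp_strict[of "(cmod lam)\<^sup>2" m] by simp
  have closed_form: "K / (1 - cmod mu) = cmod lam ^ (m * nu) * (cmod (lam ^ m - mu) / (1 - cmod mu))
      * sqrt ((1 - cmod lam ^ (2 * m)) / (1 - (cmod lam)\<^sup>2))"
    by (simp add: K_def geometric)
  have opnorm: "l2_opnorm grid (error_propagator grid m lam mu nu) = K / (1 - cmod mu)"
    if "grid \<in> {UNIV, {0..}}" for grid
    using l2_opnorm_error_propagator[OF assms(1,3) that, of lam nu] by (simp add: K_def)
  have max: "is_arg_max N (\<lambda>\<theta>. \<theta> \<in> low_freqs m) \<theta>\<^sub>0"
    using \<theta>\<^sub>0_low N_le by (auto simp: is_arg_max_def not_less)
  have unique: "\<theta> = \<theta>\<^sub>0"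
    if nz: "mu \<noteq> 0" "lam ^ m \<noteq> mu" "lam \<noteq> 0 \<or> nu = 0"
      and \<theta>: "is_arg_max N (\<lambda>\<theta>. \<theta> \<in> low_freqs m) \<theta>" for \<theta>
  proof -
    have "(\<Sum>r<m. cmod lam ^ (2 * r)) \<ge> (\<Sum>r\<in>{0}. cmod lam ^ (2 * r))"
      using assms(1) by (intro sum_mono2) auto
    then have "K \<noteq> 0"
      using nz assms(1) by (auto simp: K_def)
    have low: "\<theta> \<in> low_freqs m" and "\<not> N \<theta> < N \<theta>\<^sub>0"
      using \<theta> \<theta>\<^sub>0_low by (auto simp: is_arg_max_def)
    then have "N \<theta> = N \<theta>\<^sub>0"
      using N_le[of \<theta>] by simp
    then have "K / cmod (1 - mu * cis (- (real m * \<theta>))) = K / (1 - cmod mu)"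
      unfolding N_\<theta>\<^sub>0 unfolding N_eq .
    then have "cmod (1 - mu * cis (- (real m * \<theta>))) = 1 - cmod mu"
      using \<open>K \<noteq> 0\<close> assms(3) by (simp add: divide_inverse)
    then have "real m * \<theta> = arg_left mu"
      using norm_one_minus_mult_cis_eq_iff[OF nz(1) assms(3)] low in_low by blast
    then show ?thesis
      using assms(1) by (simp add: \<theta>\<^sub>0_def field_simps)
  qed
  show ?thesis
    unfolding N_def[symmetric] \<theta>\<^sub>0_def[symmetric] sup closed_form[symmetric]
    using opnorm max unique by blast
qed

end
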